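(* Let $(\mathbf W_n)_{n\ge1}$ be a sequence of Wigner-noises, $\mathbf W_n$ being of size $n\times n$, with a common uniform bound $K>0$ (independent of $n$) on the absolute values of their entries. Then for the corresponding sequence $(G_{\mathbf W_n})$ of Wigner-graphs, $$\lim_{n\to\infty}\|W_{G_{\mathbf W_n}}\|_\square=0\qquad\text{almost surely.}$$
   Context: A Wigner-noise of size $n$ is an $n\times n$ symmetric real random matrix $\mathbf W=(w_{ij})$ such that the entries $w_{ij}$, $1\le i\le j\le n$, are independent random variables defined on the same probability space, $w_{ji}=w_{ij}$, $\mathbb E(w_{ij})=0$ for all $i,j$, and $|w_{ij}|\le K$ for all $i,j$ with a constant $K>0$ that does not depend on $n$. (All matrices $\mathbf W_n$ are defined on a common probability space; the entries need not be identically distributed.) The Wigner-graph $G_{\mathbf W}$ is the edge-weighted graph on $[n]$ with unit vertex-weights and edge-weights $w_{ij}$. Its associated stepfunction $W_{G_{\mathbf W}}:[0,1]^2\to\mathbb R$ is obtained by dividing $[0,1]$ into $n$ consecutive intervals $I_1,\dots,I_n$ of length $1/n$ and letting $W_{G_{\mathbf W}}=w_{ij}$ on $I_i\times I_j$. The cut-norm of a bounded symmetric measurable function $W$ on $[0,1]^2$ is $\|W\|_\square=\sup_{S,T\subset[0,1]}\left|\iint_{S\times T}W(x,y)\,dx\,dy\right|$, the supremum being over measurable sets. *)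

theory Defs
  imports "HOL-Probability.Probability"
begin

text \<open>
  Matrices are indexed by \<open>{1..n}\<close>; entries outside this range are irrelevant.  Identities and
  bounds between random variables are meant almost surely, and independence is demanded of the
  entries of one matrix on and above the diagonal only.
\<close>

definition wigner_noise ::
    "'a measure \<Rightarrow> nat \<Rightarrow> real \<Rightarrow> (nat \<Rightarrow> nat \<Rightarrow> 'a \<Rightarrow> real) \<Rightarrow> bool" where
  "wigner_noise M n K w \<longleftrightarrow>
     prob_space.indep_vars M (\<lambda>_. borel) (\<lambda>(i, j). w i j) {(i, j). 1 \<le> i \<and> i \<le> j \<and> j \<le> n} \<and>
     (\<forall>i\<in>{1..n}. \<forall>j\<in>{1..n}.
        w i j \<in> borel_measurable M \<and>
        (AE \<omega> in M. w j i \<omega> = w i j \<omega>) \<and>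
        prob_space.expectation M (w i j) = 0 \<and>
        (AE \<omega> in M. \<bar>w i j \<omega>\<bar> \<le> K))"

text \<open>The vertex set is \<open>{1..num_vertices G}\<close>.\<close>

record weighted_graph =
  num_vertices :: nat
  vertex_weight :: "nat \<Rightarrow> real"
  edge_weight :: "nat \<Rightarrow> nat \<Rightarrow> real"

definition wigner_graph :: "nat \<Rightarrow> (nat \<Rightarrow> nat \<Rightarrow> real) \<Rightarrow> weighted_graph" where
  "wigner_graph n A = \<lparr>num_vertices = n, vertex_weight = (\<lambda>_. 1), edge_weight = A\<rparr>"

lemma wigner_graph_simps [simp]:
  "num_vertices (wigner_graph n A) = n"
  "vertex_weight (wigner_graph n A) i = 1"
  "edge_weight (wigner_graph n A) i j = A i j"
  by (simp_all add: wigner_graph_def)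

definition breakpoint :: "weighted_graph \<Rightarrow> nat \<Rightarrow> real" where
  "breakpoint G k = (\<Sum>i=1..k. vertex_weight G i) / (\<Sum>i=1..num_vertices G. vertex_weight G i)"

text \<open>
  The \<open>i\<close>-th interval has length proportional to the weight of vertex \<open>i\<close>.  Only the first one is
  closed on the left, so that the intervals partition \<open>[0,1]\<close>.
\<close>

definition vertex_interval :: "weighted_graph \<Rightarrow> nat \<Rightarrow> real set" where
  "vertex_interval G i =
     (if i = 1 then {0..breakpoint G 1} else {breakpoint G (i - 1)<..breakpoint G i})"

lemma vertex_interval_wigner_graph:
  assumes "1 \<le> i"
  shows "vertex_interval (wigner_graph n A) i =
    (if i = 1 then {0..1 / real n} else {(real i - 1) / real n<..real i / real n})"
  using assms by (simp add: vertex_interval_def breakpoint_def of_nat_diff)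

definition stepfunction :: "weighted_graph \<Rightarrow> real \<times> real \<Rightarrow> real" where
  "stepfunction G = (\<lambda>(x, y). \<Sum>i=1..num_vertices G. \<Sum>j=1..num_vertices G.
     edge_weight G i j * indicator (vertex_interval G i) x * indicator (vertex_interval G j) y)"

lemma stepfunction_eq_edge_weight:
  assumes "i \<in> {1..n}" "j \<in> {1..n}"
    and "x \<in> vertex_interval (wigner_graph n A) i" "y \<in> vertex_interval (wigner_graph n A) j"
  shows "stepfunction (wigner_graph n A) (x, y) = A i j"
proof -
  have uniq: "z \<in> vertex_interval (wigner_graph n A) l \<longleftrightarrow> l = k"
    if "k \<in> {1..n}" "l \<in> {1..n}" "z \<in> vertex_interval (wigner_graph n A) k" for k l z
  proof (rule ccontr)
    assume "\<not> ?thesis"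
    with that have "l \<noteq> k" and zl: "z \<in> vertex_interval (wigner_graph n A) l"
      by auto
    have n: "real n > 0"
      using that by auto
    have upper: "z * real n \<le> real m"
      and lower: "m \<noteq> 1 \<Longrightarrow> real m < z * real n + 1"
      if "m \<in> {1..n}" "z \<in> vertex_interval (wigner_graph n A) m" for m
      using that n
      by (auto simp: vertex_interval_wigner_graph field_simps split: if_splits)
    have False if "a < b" "a \<in> {1..n}" "b \<in> {1..n}"
      "z \<in> vertex_interval (wigner_graph n A) a" "z \<in> vertex_interval (wigner_graph n A) b" for a b
      using upper[of a] lower[of b] that by force
    then show False
      using \<open>l \<noteq> k\<close> zl that by (metis linorder_neqE_nat)
  qed
  have "stepfunction (wigner_graph n A) (x, y) =
      (\<Sum>k=1..n. \<Sum>l=1..n. if l = j then (if k = i then A k l else 0) else 0)"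
    unfolding stepfunction_def prod.case wigner_graph_simps
  proof (intro sum.cong refl)
    fix k l assume "k \<in> {1..n}" "l \<in> {1..n}"
    then show "A k l * indicator (vertex_interval (wigner_graph n A) k) x *
        indicator (vertex_interval (wigner_graph n A) l) y =
        (if l = j then (if k = i then A k l else 0) else 0)"
      using uniq[of i k x] uniq[of j l y] assms by (simp add: indicator_def)
  qed
  also have "\<dots> = A i j"
    using assms by (simp add: sum.delta)
  finally show ?thesis .
qed

text \<open>
  A supremum of reals, hence meaningful only if the integrals are bounded, as they are for every
  bounded measurable function on the unit square.
\<close>

definition cut_norm :: "(real \<times> real \<Rightarrow> real) \<Rightarrow> real" where
  "cut_norm U =
     (SUP (S, T)\<in>{(S, T). S \<in> sets lebesgue \<and> S \<subseteq> {0..1} \<and> T \<in> sets lebesgue \<and> T \<subseteq> {0..1}}.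
        \<bar>LINT p:S \<times> T|lebesgue. U p\<bar>)"

end

theory Submission
  imports Defs "HOL-Real_Asymp.Real_Asymp"
begin

text \<open>
  The integral of the stepfunction over \<open>S \<times> T\<close> is a bilinear form in the fractions of the
  intervals covered by \<open>S\<close> and \<open>T\<close>, so its absolute value is at most \<open>n\<^sup>-\<^sup>2\<close> times that of
  a rectangle sum \<open>\<Sum>i\<in>I. \<Sum>j\<in>J. w i j\<close>.  Folded onto the upper triangle, a rectangle sum is a
  sum of independent centred variables bounded by \<open>2K\<close>; Hoeffding's inequality bounds the
  probability that it reaches \<open>\<epsilon>n\<^sup>2\<close> by \<open>2 exp (- \<epsilon>\<^sup>2n\<^sup>2 / 8K\<^sup>2)\<close>.  This beats the \<open>4\<^sup>n\<close>
  choices of \<open>(I, J)\<close>, and Borel--Cantelli applies.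
\<close>

section \<open>Lebesgue measure of product sets\<close>

text \<open>A Lebesgue set is its Borel main part together with a subset of a Borel null set
  \<open>N\<close>. The main part serves as \<open>A\<close>, and adding all of \<open>N\<close>
  gives \<open>C\<close> without changing the measure.\<close>

lemma borel_sandwich_lebesgue:
  fixes U :: "'a::euclidean_space set"
  assumes "U \<in> sets lebesgue"
  obtains A C where "A \<in> sets borel" "C \<in> sets borel" "A \<subseteq> U" "U \<subseteq> C"
    "emeasure lborel A = emeasure lebesgue U" "emeasure lborel C = emeasure lebesgue U"
proof -
  obtain N where N: "N \<in> null_sets lborel" "null_part lborel U \<subseteq> N"
    using null_part[OF assms] by blast
  let ?A = "main_part lborel U"
  have A: "?A \<in> sets lborel"
    using assms by (rule main_part_sets)
  have sub: "?A \<subseteq> U" "U \<subseteq> ?A \<union> N"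
    using main_part_null_part_Un[OF assms] N(2) by blast+
  have "emeasure lborel (?A \<union> N) = emeasure lborel ?A"
    using A N by (intro emeasure_Un_null_set)
  then show ?thesis
    using that[OF _ _ sub] A N(1) assms by auto
qed

text \<open>\<open>lebesgue\<close> on the product space is the completion of the Borel product
  measure. So \<open>S \<times> T\<close> is squeezed between the Borel rectangles
  \<open>A \<times> B\<close> and \<open>C \<times> D\<close>, which have the same measure, and
  completeness makes it measurable.\<close>

lemma
  fixes S :: "'a::euclidean_space set" and T :: "'b::euclidean_space set"
  assumes "S \<in> lmeasurable" "T \<in> lmeasurable"
  shows lmeasurable_Times: "S \<times> T \<in> lmeasurable"
    and measure_lebesgue_Times:
      "measure lebesgue (S \<times> T) = measure lebesgue S * measure lebesgue T"
proof -
  have Times: "emeasure lborel (A \<times> B) = emeasure lborel A * emeasure lborel B"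
    if "A \<in> sets borel" "B \<in> sets borel" for A :: "'a set" and B :: "'b set"
    using that by (simp add: lborel.emeasure_pair_measure_Times flip: lborel_prod)
  obtain A C where A: "A \<in> sets borel" "C \<in> sets borel" "A \<subseteq> S" "S \<subseteq> C"
      "emeasure lborel A = emeasure lebesgue S" "emeasure lborel C = emeasure lebesgue S"
    using borel_sandwich_lebesgue[of S] assms by blast
  obtain B D where B: "B \<in> sets borel" "D \<in> sets borel" "B \<subseteq> T" "T \<subseteq> D"
      "emeasure lborel B = emeasure lebesgue T" "emeasure lborel D = emeasure lebesgue T"
    using borel_sandwich_lebesgue[of T] assms by blast
  let ?m = "emeasure lebesgue S * emeasure lebesgue T"
  have meas: "A \<times> B \<in> sets lebesgue" "C \<times> D \<in> sets lebesgue"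
    using A B by (auto intro!: sets_completionI_sets borel_Times)
  have em: "emeasure lebesgue (A \<times> B) = ?m" "emeasure lebesgue (C \<times> D) = ?m"
    using A B by (auto simp: Times borel_Times)
  \<comment> \<open>Finiteness is what turns equal measures of the inner and outer rectangle into a
    null difference.\<close>
  have fin: "?m < \<infinity>"
    using assms by (auto simp: fmeasurable_def ennreal_mult_less_top)
  have sub: "A \<times> B \<subseteq> S \<times> T" "S \<times> T \<subseteq> C \<times> D"
    using A(3,4) B(3,4) by auto
  have ST: "S \<times> T \<in> sets lebesgue"
    using em fin by (intro completion.complete_sets_sandwich[OF meas sub]) metis+
  have "emeasure lebesgue (S \<times> T) = ?m"
  proof (rule antisym)
    show "emeasure lebesgue (S \<times> T) \<le> ?m"
      unfolding em(2)[symmetric] using sub meas by (intro emeasure_mono)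
    show "?m \<le> emeasure lebesgue (S \<times> T)"
      unfolding em(1)[symmetric] using sub ST by (intro emeasure_mono)
  qed
  then show "S \<times> T \<in> lmeasurable"
    and "measure lebesgue (S \<times> T) = measure lebesgue S * measure lebesgue T"
    using ST fin by (auto simp: fmeasurable_def measure_def enn2real_mult)
qed

section \<open>Rounding bilinear forms to rectangle sums\<close>

text \<open>A linear form on the unit cube is extremal at a vertex: if the weighted sum is
  nonnegative, keep exactly the positive \<open>c i\<close> with weight 1, otherwise exactly the
  negative ones.\<close>

lemma abs_weighted_sum_le_subset_sum:
  fixes a c :: "'a \<Rightarrow> real"
  assumes "finite I" and a: "\<And>i. i \<in> I \<Longrightarrow> 0 \<le> a i \<and> a i \<le> 1"
  shows "\<exists>A\<subseteq>I. \<bar>\<Sum>i\<in>I. a i * c i\<bar> \<le> \<bar>\<Sum>i\<in>A. c i\<bar>"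
proof -
  have *: "(\<Sum>i\<in>I. a i * d i) \<le> (\<Sum>i\<in>{i\<in>I. 0 < d i}. d i)" for d :: "'a \<Rightarrow> real"
  proof -
    have "a i * d i \<le> (if 0 < d i then d i else 0)" if "i \<in> I" for i
      using a[OF that] by (auto simp: mult_left_le_one_le mult_nonneg_nonpos)
    then have "(\<Sum>i\<in>I. a i * d i) \<le> (\<Sum>i\<in>I. if 0 < d i then d i else 0)"
      by (rule sum_mono)
    also have "\<dots> = (\<Sum>i\<in>{i\<in>I. 0 < d i}. d i)"
      using assms(1) by (simp add: sum.inter_filter)
    finally show ?thesis .
  qed
  consider "\<bar>\<Sum>i\<in>I. a i * c i\<bar> = (\<Sum>i\<in>I. a i * c i)"
    | "\<bar>\<Sum>i\<in>I. a i * c i\<bar> = (\<Sum>i\<in>I. a i * - c i)"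
    by (cases "(\<Sum>i\<in>I. a i * c i) \<ge> 0") (simp_all add: sum_negf)
  then show ?thesis
  proof cases
    case 1
    with *[of c] show ?thesis
      by (intro exI[of _ "{i\<in>I. 0 < c i}"]) auto
  next
    case 2
    with *[of "\<lambda>i. - c i"] show ?thesis
      by (intro exI[of _ "{i\<in>I. 0 < - c i}"]) (auto simp: sum_negf)
  qed
qed

text \<open>The form is linear in each argument separately: with \<open>b\<close> fixed,
  \<open>a\<close> is rounded to a set \<open>A\<close>; with \<open>A\<close> fixed,
  \<open>b\<close> is then rounded to \<open>B\<close>.\<close>

lemma abs_bilinear_le_rectangle_sum:
  fixes a :: "'a \<Rightarrow> real" and b :: "'b \<Rightarrow> real" and c :: "'a \<Rightarrow> 'b \<Rightarrow> real"
  assumes "finite I" "finite J"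
    and "\<And>i. i \<in> I \<Longrightarrow> 0 \<le> a i \<and> a i \<le> 1" and "\<And>j. j \<in> J \<Longrightarrow> 0 \<le> b j \<and> b j \<le> 1"
  shows "\<exists>A\<subseteq>I. \<exists>B\<subseteq>J. \<bar>\<Sum>i\<in>I. \<Sum>j\<in>J. a i * b j * c i j\<bar> \<le> \<bar>\<Sum>i\<in>A. \<Sum>j\<in>B. c i j\<bar>"
proof -
  obtain A where A: "A \<subseteq> I"
    "\<bar>\<Sum>i\<in>I. a i * (\<Sum>j\<in>J. b j * c i j)\<bar> \<le> \<bar>\<Sum>i\<in>A. \<Sum>j\<in>J. b j * c i j\<bar>"
    using abs_weighted_sum_le_subset_sum[of I a "\<lambda>i. \<Sum>j\<in>J. b j * c i j"] assms by blast
  obtain B where B: "B \<subseteq> J"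
    "\<bar>\<Sum>j\<in>J. b j * (\<Sum>i\<in>A. c i j)\<bar> \<le> \<bar>\<Sum>j\<in>B. \<Sum>i\<in>A. c i j\<bar>"
    using abs_weighted_sum_le_subset_sum[of J b "\<lambda>j. \<Sum>i\<in>A. c i j"] assms by blast
  have "\<bar>\<Sum>i\<in>I. \<Sum>j\<in>J. a i * b j * c i j\<bar> \<le> \<bar>\<Sum>i\<in>A. \<Sum>j\<in>J. b j * c i j\<bar>"
    using A(2) by (simp add: sum_distrib_left mult.assoc)
  also have "(\<Sum>i\<in>A. \<Sum>j\<in>J. b j * c i j) = (\<Sum>j\<in>J. b j * (\<Sum>i\<in>A. c i j))"
    by (subst sum.swap) (simp add: sum_distrib_left)
  also have "\<bar>\<dots>\<bar> \<le> \<bar>\<Sum>i\<in>A. \<Sum>j\<in>B. c i j\<bar>"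
    using B(2) by (simp add: sum.swap[of _ A])
  finally show ?thesis
    using A(1) B(1) by blast
qed

section \<open>From stepfunction integrals to the cut-norm\<close>

lemma
  assumes "1 \<le> i"
  shows lmeasurable_vertex_interval:
      "vertex_interval (wigner_graph n A) i \<in> lmeasurable"
    and measure_vertex_interval:
      "measure lebesgue (vertex_interval (wigner_graph n A) i) = 1 / real n"
proof -
  have *: "{a<..b} \<in> lmeasurable" for a b :: real
    by (rule fmeasurableI2[of "{a..b}"]) auto
  show "vertex_interval (wigner_graph n A) i \<in> lmeasurable"
    using assms * by (simp add: vertex_interval_wigner_graph)
  show "measure lebesgue (vertex_interval (wigner_graph n A) i) = 1 / real n"
    using assms
    by (auto simp: vertex_interval_wigner_graph divide_right_mono simp flip: diff_divide_distrib)
qed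

text \<open>Restricted to \<open>S \<times> T\<close>, the stepfunction is a finite combination of
  indicators of the rectangles \<open>(S \<inter> V i) \<times> (T \<inter> V j)\<close>, each of
  finite product measure.\<close>

lemma set_integral_stepfunction:
  fixes n :: nat and A :: "nat \<Rightarrow> nat \<Rightarrow> real"
  assumes S: "S \<in> sets lebesgue" and T: "T \<in> sets lebesgue"
  defines "V \<equiv> vertex_interval (wigner_graph n A)"
  shows "(LINT p:S \<times> T|lebesgue. stepfunction (wigner_graph n A) p) =
    (\<Sum>i=1..n. \<Sum>j=1..n. A i j * (measure lebesgue (S \<inter> V i) * measure lebesgue (T \<inter> V j)))"
proof -
  have lm: "U \<inter> V i \<in> lmeasurable" if "i \<in> {1..n}" "U \<in> sets lebesgue" for U i
    using that lmeasurable_vertex_interval[of i n A] fmeasurable_Int_fmeasurable[of "V i" lebesgue U]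
    by (simp add: V_def Int_commute)
  have rect: "(S \<inter> V i) \<times> (T \<inter> V j) \<in> lmeasurable" if "i \<in> {1..n}" "j \<in> {1..n}" for i j
    using that lm S T by (intro lmeasurable_Times) auto
  have "indicator (S \<times> T) p *\<^sub>R stepfunction (wigner_graph n A) p =
      (\<Sum>i=1..n. \<Sum>j=1..n. A i j * indicator ((S \<inter> V i) \<times> (T \<inter> V j)) p)" for p
    by (cases p) (simp add: stepfunction_def V_def indicator_times sum_distrib_left
        indicator_inter_arith mult_ac)
  then have "(LINT p:S \<times> T|lebesgue. stepfunction (wigner_graph n A) p) =
      (LINT p|lebesgue. (\<Sum>i=1..n. \<Sum>j=1..n. A i j * indicator ((S \<inter> V i) \<times> (T \<inter> V j)) p))"
    by (simp add: set_lebesgue_integral_def)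
  also have "\<dots> = (\<Sum>i=1..n. \<Sum>j=1..n. A i j * measure lebesgue ((S \<inter> V i) \<times> (T \<inter> V j)))"
  proof (subst Bochner_Integration.integral_sum)
    have int: "integrable lebesgue (\<lambda>p. A i j * indicator ((S \<inter> V i) \<times> (T \<inter> V j)) p)"
      if "i \<in> {1..n}" "j \<in> {1..n}" for i j
      using rect[OF that]
      by (intro integrable_mult_right integrable_real_indicator)
        (simp_all add: fmeasurable_def del: emeasure_completion)
    then show "integrable lebesgue
        (\<lambda>p. \<Sum>j=1..n. A i j * indicator ((S \<inter> V i) \<times> (T \<inter> V j)) p)" if "i \<in> {1..n}" for i
      using that by (intro Bochner_Integration.integrable_sum)
    show "(\<Sum>i=1..n. LINT p|lebesgue.
        (\<Sum>j=1..n. A i j * indicator ((S \<inter> V i) \<times> (T \<inter> V j)) p)) =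
      (\<Sum>i=1..n. \<Sum>j=1..n. A i j * measure lebesgue ((S \<inter> V i) \<times> (T \<inter> V j)))"
    proof (intro sum.cong refl)
      fix i assume i: "i \<in> {1..n}"
      have "(LINT p|lebesgue. (\<Sum>j=1..n. A i j * indicator ((S \<inter> V i) \<times> (T \<inter> V j)) p)) =
          (\<Sum>j=1..n. LINT p|lebesgue. A i j * indicator ((S \<inter> V i) \<times> (T \<inter> V j)) p)"
        using int i by (intro Bochner_Integration.integral_sum)
      also have "\<dots> = (\<Sum>j=1..n. A i j * measure lebesgue ((S \<inter> V i) \<times> (T \<inter> V j)))"
        by (simp only: integral_mult_right_zero integral_indicator) simp
      finally show "(LINT p|lebesgue. (\<Sum>j=1..n. A i j * indicator ((S \<inter> V i) \<times> (T \<inter> V j)) p)) =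
          (\<Sum>j=1..n. A i j * measure lebesgue ((S \<inter> V i) \<times> (T \<inter> V j)))" .
    qed
  qed
  also have "\<dots> = (\<Sum>i=1..n. \<Sum>j=1..n.
      A i j * (measure lebesgue (S \<inter> V i) * measure lebesgue (T \<inter> V j)))"
    using lm S T by (intro sum.cong refl) (simp add: measure_lebesgue_Times)
  finally show ?thesis .
qed

lemma abs_set_integral_stepfunction_le:
  assumes n: "n \<ge> 1" and S: "S \<in> sets lebesgue" and T: "T \<in> sets lebesgue"
    and bound: "\<And>I J. I \<subseteq> {1..n} \<Longrightarrow> J \<subseteq> {1..n} \<Longrightarrow> \<bar>\<Sum>i\<in>I. \<Sum>j\<in>J. A i j\<bar> \<le> e * real n ^ 2"
  shows "\<bar>LINT p:S \<times> T|lebesgue. stepfunction (wigner_graph n A) p\<bar> \<le> e"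
proof -
  define V where "V = vertex_interval (wigner_graph n A)"
  \<comment> \<open>\<open>m U i\<close> is the fraction of the interval \<open>V i\<close> covered
    by \<open>U\<close>. The factor \<open>n\<close> occurs once for \<open>S\<close> and once for
    \<open>T\<close>, hence the factor \<open>n\<^sup>2\<close> on the integral below.\<close>
  define m where "m U i = real n * measure lebesgue (U \<inter> V i)" for U i
  have m: "0 \<le> m U i \<and> m U i \<le> 1" if "i \<in> {1..n}" "U \<in> sets lebesgue" for U i
  proof -
    have "measure lebesgue (U \<inter> V i) \<le> measure lebesgue (V i)"
      using that lmeasurable_vertex_interval[of i n A]
      by (intro measure_mono_fmeasurable) (auto simp: V_def)
    also have "\<dots> = 1 / real n"
      using that measure_vertex_interval[of i n A] by (simp add: V_def)
    finally show ?thesis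
      using n by (simp add: m_def field_simps)
  qed
  obtain I J where IJ: "I \<subseteq> {1..n}" "J \<subseteq> {1..n}"
    "\<bar>\<Sum>i=1..n. \<Sum>j=1..n. m S i * m T j * A i j\<bar> \<le> \<bar>\<Sum>i\<in>I. \<Sum>j\<in>J. A i j\<bar>"
    using abs_bilinear_le_rectangle_sum[of "{1..n}" "{1..n}" "m S" "m T" A] m S T by blast
  let ?L = "LINT p:S \<times> T|lebesgue. stepfunction (wigner_graph n A) p"
  have "real n ^ 2 * ?L = (\<Sum>i=1..n. \<Sum>j=1..n. m S i * m T j * A i j)"
    by (simp add: set_integral_stepfunction[OF S T] sum_distrib_left m_def V_def
        power2_eq_square mult_ac)
  moreover have "real n ^ 2 * \<bar>?L\<bar> = \<bar>real n ^ 2 * ?L\<bar>"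
    by (simp add: abs_mult)
  ultimately have "real n ^ 2 * \<bar>?L\<bar> \<le> e * real n ^ 2"
    using order_trans[OF IJ(3) bound[OF IJ(1,2)]] by simp
  then show ?thesis
    using n by (simp add: mult.commute)
qed

lemma cut_norm_stepfunction_bounds:
  assumes "n \<ge> 1"
    and "\<And>I J. I \<subseteq> {1..n} \<Longrightarrow> J \<subseteq> {1..n} \<Longrightarrow> \<bar>\<Sum>i\<in>I. \<Sum>j\<in>J. A i j\<bar> \<le> e * real n ^ 2"
  shows "0 \<le> cut_norm (stepfunction (wigner_graph n A))"
    and "cut_norm (stepfunction (wigner_graph n A)) \<le> e"
proof -
  let ?X = "{(S, T). S \<in> sets lebesgue \<and> S \<subseteq> {0..1::real} \<and> T \<in> sets lebesgue \<and> T \<subseteq> {0..1::real}}"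
  let ?f = "\<lambda>(S, T). \<bar>LINT p:S \<times> T|lebesgue. stepfunction (wigner_graph n A) p\<bar>"
  have le: "?f ST \<le> e" if "ST \<in> ?X" for ST
    using that abs_set_integral_stepfunction_le[OF assms(1) _ _ assms(2)] by auto
  have ne: "({}, {}) \<in> ?X"
    by auto
  show "cut_norm (stepfunction (wigner_graph n A)) \<le> e"
    unfolding cut_norm_def using ne le by (intro cSUP_least) blast+
  \<comment> \<open>The empty rectangle contributes the value 0. The bound \<open>e\<close> also
    makes the set of values bounded above, so that the real supremum dominates this value.\<close>
  have "?f ({}, {}) \<le> (SUP ST\<in>?X. ?f ST)"
    using ne le by (intro cSUP_upper bdd_aboveI2[of _ _ e]) blast+
  then show "0 \<le> cut_norm (stepfunction (wigner_graph n A))"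
    unfolding cut_norm_def by simp
qed

section \<open>Folding and concentration of rectangle sums\<close>

text \<open>The coefficient of \<open>c i j\<close> counts how many of the positions
  \<open>(i, j)\<close> and \<open>(j, i)\<close> lie in \<open>I \<times> J\<close>; the condition
  \<open>i \<noteq> j\<close> keeps diagonal entries from being counted twice.\<close>

lemma sum_rectangle_eq_sum_upper:
  fixes c :: "nat \<Rightarrow> nat \<Rightarrow> real"
  assumes "I \<subseteq> {1..n}" "J \<subseteq> {1..n}"
    and sym: "\<And>i j. i \<in> {1..n} \<Longrightarrow> j \<in> {1..n} \<Longrightarrow> c j i = c i j"
  shows "(\<Sum>i\<in>I. \<Sum>j\<in>J. c i j) = (\<Sum>(i, j)\<in>{(i, j). 1 \<le> i \<and> i \<le> j \<and> j \<le> n}.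
    (of_bool (i \<in> I \<and> j \<in> J) + of_bool (i \<noteq> j \<and> j \<in> I \<and> i \<in> J)) * c i j)"
proof -
  let ?U = "{(i, j). 1 \<le> i \<and> i \<le> j \<and> j \<le> n}"
  let ?f = "\<lambda>(i, j). of_bool (i \<in> I \<and> j \<in> J) * c i j"
  let ?L = "{(i, j). 1 \<le> i \<and> i < j \<and> j \<le> n}"
  have finU: "finite ?U"
    by (rule finite_subset[of _ "{1..n} \<times> {1..n}"]) auto
  have finL: "finite ?L"
    by (rule finite_subset[OF _ finU]) auto
  have "(\<Sum>i\<in>I. \<Sum>j\<in>J. c i j) = (\<Sum>(i, j)\<in>I \<times> J. c i j)"
    by (simp add: sum.cartesian_product)
  also have "\<dots> = sum ?f ({1..n} \<times> {1..n})"
    using assms(1,2) by (intro sum.mono_neutral_cong_left) auto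
  \<comment> \<open>The square is the closed upper triangle plus the mirror image of the open one,
    so the diagonal belongs to the first piece only.\<close>
  also have "{1..n} \<times> {1..n} = ?U \<union> prod.swap ` ?L"
    by (auto simp: image_iff)
  also have "sum ?f \<dots> = sum ?f ?U + sum ?f (prod.swap ` ?L)"
    using finU finL by (intro sum.union_disjoint) auto
  also have "sum ?f (prod.swap ` ?L) = sum (?f \<circ> prod.swap) ?L"
    by (intro sum.reindex) auto
  \<comment> \<open>Symmetry turns \<open>c j i\<close> back into \<open>c i j\<close>; the index
    set grows from \<open>?L\<close> to \<open>?U\<close> by diagonal terms with coefficient
    0.\<close>
  also have "\<dots> = (\<Sum>(i, j)\<in>?U. of_bool (i \<noteq> j \<and> j \<in> I \<and> i \<in> J) * c i j)"
    using finU sym by (intro sum.mono_neutral_cong_left) auto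
  also have "sum ?f ?U + \<dots> = (\<Sum>(i, j)\<in>?U.
    (of_bool (i \<in> I \<and> j \<in> J) + of_bool (i \<noteq> j \<and> j \<in> I \<and> i \<in> J)) * c i j)"
    by (simp add: sum.distrib[symmetric] case_prod_unfold distrib_right del: of_bool_conj)
  finally show ?thesis .
qed

context prob_space
begin

text \<open>Each pair has its own exceptional null set. There are finitely many pairs, so outside a
  single null set the folding can be carried out pointwise.\<close>

lemma wigner_noise_AE_symmetric:
  assumes "wigner_noise M n K w"
  shows "AE \<omega> in M. \<forall>i\<in>{1..n}. \<forall>j\<in>{1..n}. w j i \<omega> = w i j \<omega>"
  using assms unfolding wigner_noise_def by (intro AE_finite_allI) auto

lemma prob_rectangle_sum_ge_le:
  assumes noise: "wigner_noise M n K w" and K: "K > 0" and n: "n \<ge> 1" and e: "e \<ge> 0"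
    and I: "I \<subseteq> {1..n}" and J: "J \<subseteq> {1..n}"
  shows "prob {\<omega>\<in>space M. \<bar>\<Sum>i\<in>I. \<Sum>j\<in>J. w i j \<omega>\<bar> \<ge> e * real n ^ 2}
    \<le> 2 * exp (- (e\<^sup>2 * real n ^ 2 / (8 * K\<^sup>2)))"
proof -
  define U where "U = {(i, j). 1 \<le> i \<and> i \<le> j \<and> j \<le> n}"
  define d :: "nat \<times> nat \<Rightarrow> real"
    where "d = (\<lambda>(i, j). of_bool (i \<in> I \<and> j \<in> J) + of_bool (i \<noteq> j \<and> j \<in> I \<and> i \<in> J))"
  define X where "X = (\<lambda>p \<omega>. d p * w (fst p) (snd p) \<omega>)"
  have d: "0 \<le> d p \<and> d p \<le> 2" for p
    by (cases p) (auto simp: d_def)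
  have U: "U \<subseteq> {1..n} \<times> {1..n}" "finite U"
  proof -
    show "U \<subseteq> {1..n} \<times> {1..n}"
      by (auto simp: U_def)
    then show "finite U"
      by (rule finite_subset) simp
  qed
  have indep: "indep_vars (\<lambda>_. borel) (\<lambda>(i, j). w i j) U"
    and meas: "\<And>i j. i \<in> {1..n} \<Longrightarrow> j \<in> {1..n} \<Longrightarrow> w i j \<in> borel_measurable M"
    and mean: "\<And>i j. i \<in> {1..n} \<Longrightarrow> j \<in> {1..n} \<Longrightarrow> expectation (w i j) = 0"
    and bnd: "\<And>i j. i \<in> {1..n} \<Longrightarrow> j \<in> {1..n} \<Longrightarrow> AE \<omega> in M. \<bar>w i j \<omega>\<bar> \<le> K"
    using noise by (auto simp: wigner_noise_def U_def)
  have EX: "(\<Sum>p\<in>U. expectation (X p)) = 0"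
    using U mean by (intro sum.neutral) (auto simp: X_def)
  \<comment> \<open>The coefficients \<open>d p\<close> are at most 2 and the entries at most
    \<open>K\<close> in absolute value, which gives the range of \<open>X p\<close>; the final 0 is
    the mean of the sum, by \<open>EX\<close>.\<close>
  interpret Hoeffding_ineq M U X "\<lambda>_. -2 * K" "\<lambda>_. 2 * K" 0
  proof unfold_locales
    \<comment> \<open>Each summand is a fixed scalar multiple of the entry at \<open>p\<close>, so
      independence of the entries carries over.\<close>
    have "indep_vars (\<lambda>_. borel) (\<lambda>p \<omega>. d p * (case p of (i, j) \<Rightarrow> w i j) \<omega>) U"
      by (rule indep_vars_compose2[OF indep]) simp
    then show "indep_vars (\<lambda>_. borel) X U"
      by (simp add: X_def case_prod_unfold)
  next
    fix p assume "p \<in> U"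
    then have "AE \<omega> in M. \<bar>w (fst p) (snd p) \<omega>\<bar> \<le> K"
      using U bnd by auto
    then show "AE \<omega> in M. X p \<omega> \<in> {-2 * K..2 * K}"
    proof eventually_elim
      case (elim \<omega>)
      have "\<bar>X p \<omega>\<bar> \<le> 2 * K"
        unfolding X_def abs_mult using d[of p] elim by (intro mult_mono) auto
      then show ?case
        by auto
    qed
  qed (use U EX in auto)
  have cardU: "0 < card U" "card U \<le> n ^ 2"
  proof -
    have "(1, 1) \<in> U"
      using n by (auto simp: U_def)
    then show "0 < card U"
      using U by (auto simp: card_gt_0_iff)
    show "card U \<le> n ^ 2"
      using card_mono[OF _ U(1)] by (simp add: power2_eq_square)
  qed
  have sq: "(\<Sum>p\<in>U. (2 * K - -2 * K)\<^sup>2) = 16 * K\<^sup>2 * real (card U)"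
    by (simp add: power2_eq_square)
  have "AE \<omega> in M. (\<Sum>i\<in>I. \<Sum>j\<in>J. w i j \<omega>) = (\<Sum>p\<in>U. X p \<omega>)"
    using wigner_noise_AE_symmetric[OF noise]
  proof eventually_elim
    case (elim \<omega>)
    then show ?case
      using sum_rectangle_eq_sum_upper[OF I J, of "\<lambda>i j. w i j \<omega>"]
      by (simp add: U_def X_def d_def case_prod_unfold)
  qed
  moreover have "(\<lambda>\<omega>. \<Sum>i\<in>I. \<Sum>j\<in>J. w i j \<omega>) \<in> borel_measurable M"
    using I J by (intro borel_measurable_sum meas) auto
  moreover have "(\<lambda>\<omega>. \<Sum>p\<in>U. X p \<omega>) \<in> borel_measurable M"
    by (intro borel_measurable_sum) simp
  \<comment> \<open>The rectangle sum and the folded sum agree only almost surely, so the events are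
    compared through their probabilities.\<close>
  ultimately have "prob {\<omega>\<in>space M. \<bar>\<Sum>i\<in>I. \<Sum>j\<in>J. w i j \<omega>\<bar> \<ge> e * real n ^ 2} =
      prob {\<omega>\<in>space M. \<bar>(\<Sum>p\<in>U. X p \<omega>) - 0\<bar> \<ge> e * real n ^ 2}"
    by (intro prob_eq_AE) auto
  also have "\<dots>
      \<le> 2 * exp (-2 * (e * real n ^ 2)\<^sup>2 / (\<Sum>p\<in>U. (2 * K - -2 * K)\<^sup>2))"
    by (rule Hoeffding_ineq_abs_ge) (use e K cardU sq in auto)
  \<comment> \<open>The exponent is \<open>-2 e\<^sup>2 n\<^sup>4 / (16 K\<^sup>2 card U)\<close>,
    where 16 is the square of the range width \<open>4K\<close> divided by \<open>K\<^sup>2\<close>.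
    Replacing \<open>card U\<close> by the upper bound \<open>n\<^sup>2\<close> leaves
    \<open>-e\<^sup>2 n\<^sup>2 / (8 K\<^sup>2)\<close>.\<close>
  also have "\<dots> \<le> 2 * exp (- (e\<^sup>2 * real n ^ 2 / (8 * K\<^sup>2)))"
  proof -
    have "e\<^sup>2 * real n ^ 2 / (8 * K\<^sup>2) = 2 * (e * real n ^ 2)\<^sup>2 / (16 * K\<^sup>2 * real (n ^ 2))"
      using n K by (simp add: field_simps power2_eq_square)
    also have "\<dots> \<le> 2 * (e * real n ^ 2)\<^sup>2 / (16 * K\<^sup>2 * real (card U))"
      using cardU K n by (intro divide_left_mono mult_left_mono) auto
    finally show ?thesis
      unfolding sq by simp
  qed
  finally show ?thesis .
qed

text \<open>Union bound over the \<open>2^n * 2^n\<close> pairs of subsets; as there are finitely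
  many, the exceptional set is again an event.\<close>

lemma prob_exists_rectangle_sum_ge_le:
  assumes noise: "wigner_noise M n K w" and "K > 0" "n \<ge> 1" "e \<ge> 0"
  defines "E \<equiv> {\<omega>\<in>space M. \<exists>I\<subseteq>{1..n}. \<exists>J\<subseteq>{1..n}. \<bar>\<Sum>i\<in>I. \<Sum>j\<in>J. w i j \<omega>\<bar> \<ge> e * real n ^ 2}"
  shows "E \<in> events" and "prob E \<le> 4 ^ n * (2 * exp (- (e\<^sup>2 * real n ^ 2 / (8 * K\<^sup>2))))"
proof -
  let ?P = "Pow {1..n} \<times> Pow {1..n}"
  define F where "F = (\<lambda>(I, J). {\<omega>\<in>space M. \<bar>\<Sum>i\<in>I. \<Sum>j\<in>J. w i j \<omega>\<bar> \<ge> e * real n ^ 2})"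
  have E: "E = (\<Union>p\<in>?P. F p)"
    by (auto simp: E_def F_def)
  have F: "F p \<in> events" if "p \<in> ?P" for p
  proof -
    have "(\<lambda>\<omega>. \<Sum>i\<in>fst p. \<Sum>j\<in>snd p. w i j \<omega>) \<in> borel_measurable M"
      using that noise by (intro borel_measurable_sum) (force simp: wigner_noise_def)
    then show ?thesis
      by (auto simp: F_def case_prod_unfold)
  qed
  then show "E \<in> events"
    unfolding E by (intro sets.finite_UN) auto
  have "prob E \<le> (\<Sum>p\<in>?P. prob (F p))"
    unfolding E using F by (intro finite_measure_subadditive_finite) auto
  also have "\<dots> \<le> (\<Sum>p\<in>?P. 2 * exp (- (e\<^sup>2 * real n ^ 2 / (8 * K\<^sup>2))))"
    using prob_rectangle_sum_ge_le[OF assms(1-4)] by (intro sum_mono) (auto simp: F_def)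
  also have "\<dots> = 4 ^ n * (2 * exp (- (e\<^sup>2 * real n ^ 2 / (8 * K\<^sup>2))))"
    by (simp add: card_cartesian_product card_Pow flip: power_mult_distrib)
  finally show "prob E \<le> 4 ^ n * (2 * exp (- (e\<^sup>2 * real n ^ 2 / (8 * K\<^sup>2))))" .
qed

section \<open>Borel-Cantelli and almost sure convergence\<close>

lemma AE_eventually_rectangle_sums_less:
  assumes noise: "\<And>n. n \<ge> 1 \<Longrightarrow> wigner_noise M n K (W n)" and "K > 0" "e > 0"
  shows "AE \<omega> in M. \<forall>\<^sub>F n in sequentially. \<forall>I\<subseteq>{1..n}. \<forall>J\<subseteq>{1..n}.
    \<bar>\<Sum>i\<in>I. \<Sum>j\<in>J. W n i j \<omega>\<bar> < e * real n ^ 2"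
proof -
  \<comment> \<open>The noise assumption starts at \<open>n = 1\<close>, so the event for
    \<open>n = 0\<close> is set to be empty.\<close>
  define E where "E n = (if n = 0 then {} else {\<omega>\<in>space M. \<exists>I\<subseteq>{1..n}. \<exists>J\<subseteq>{1..n}.
    \<bar>\<Sum>i\<in>I. \<Sum>j\<in>J. W n i j \<omega>\<bar> \<ge> e * real n ^ 2})" for n
  define c where "c = e\<^sup>2 / (8 * K\<^sup>2)"
  have c: "c > 0"
    using assms by (simp add: c_def)
  have E: "E n \<in> events" "prob (E n) \<le> 4 ^ n * (2 * exp (- (c * real n ^ 2)))" for n
    using prob_exists_rectangle_sum_ge_le[of n K "W n" e] assms
    by (cases "n = 0"; simp add: E_def c_def)+
  have "summable (\<lambda>n. 4 ^ n * (2 * exp (- (c * real n ^ 2))))"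
  proof (rule summable_comparison_test_bigo)
    show "summable (\<lambda>n. norm ((1/2) ^ n :: real))"
      by (simp add: summable_geometric)
    \<comment> \<open>The term is a constant times \<open>exp (n ln 4 - c n\<^sup>2)\<close>, and
      the quadratic part makes it smaller than any geometric sequence; the ratio 1/2 is one choice
      that is summable.\<close>
    show "(\<lambda>n. 4 ^ n * (2 * exp (- (c * real n ^ 2)))) \<in> O(\<lambda>n. (1/2) ^ n)"
      using c by real_asymp
  qed
  then have "summable (\<lambda>n. prob (E n))"
    by (rule summable_comparison_test[rotated]) (use E in auto)
  then have "AE \<omega> in M. \<forall>\<^sub>F n in sequentially. \<omega> \<in> space M - E n"
    using E by (intro borel_cantelli_AE1) (auto simp: emeasure_eq_measure)
  then show ?thesis
  proof eventually_elim
    case (elim \<omega>)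
    with eventually_gt_at_top[of 0] show ?case
      by eventually_elim (auto simp: E_def not_le)
  qed
qed

end

theorem theorem26:
  fixes M :: "'a measure"
    and W :: "nat \<Rightarrow> nat \<Rightarrow> nat \<Rightarrow> 'a \<Rightarrow> real"
    and K :: real
  assumes "prob_space M"
    and "K > 0"
    and "\<And>n. n \<ge> 1 \<Longrightarrow> wigner_noise M n K (W n)"
  shows "AE \<omega> in M.
    (\<lambda>n. cut_norm (stepfunction (wigner_graph n (\<lambda>i j. W n i j \<omega>)))) \<longlonglongrightarrow> 0"
proof -
  interpret prob_space M
    by fact
  \<comment> \<open>Restricting the thresholds to the countable family \<open>1 / (k + 1)\<close>
    yields one null set outside which the bounds hold for all \<open>k\<close>, hence for every
    positive \<open>e\<close>.\<close>
  have "AE \<omega> in M. \<forall>k. \<forall>\<^sub>F n in sequentially. \<forall>I\<subseteq>{1..n}. \<forall>J\<subseteq>{1..n}.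
      \<bar>\<Sum>i\<in>I. \<Sum>j\<in>J. W n i j \<omega>\<bar> < inverse (real (Suc k)) * real n ^ 2"
    unfolding AE_all_countable
    using AE_eventually_rectangle_sums_less[OF assms(3) assms(2)] by auto
  then show ?thesis
  proof eventually_elim
    case (elim \<omega>)
    show ?case
    proof (rule tendstoI)
      fix e :: real assume "e > 0"
      then obtain k where k: "inverse (real (Suc k)) < e"
        using reals_Archimedean by blast
      show "\<forall>\<^sub>F n in sequentially.
          dist (cut_norm (stepfunction (wigner_graph n (\<lambda>i j. W n i j \<omega>)))) 0 < e"
        using elim[rule_format, of k] eventually_ge_at_top[of 1]
      proof eventually_elim
        case (elim n)
        then have *: "\<bar>\<Sum>i\<in>I. \<Sum>j\<in>J. W n i j \<omega>\<bar> \<le> inverse (real (Suc k)) * real n ^ 2"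
          if "I \<subseteq> {1..n}" "J \<subseteq> {1..n}" for I J
          using that by (simp add: less_imp_le)
        show ?case
          using cut_norm_stepfunction_bounds[OF elim(2) *] k by (simp add: dist_real_def)
      qed
    qed
  qed
qed

end
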